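(* Let $C$ be a graph of colors which is a tree, and let $(\Delta_i)_{i\in V(C)}$ be data for symmetry-restricted graphs over $C$ (finite permutation groups whose orbits are indexed by the edge-colors departing $i$). Let $G$ and $G'$ be two finite symmetry-restricted graphs for these data. If $G$ and $G'$ have a common covering (a symmetry-restricted graph for these data, possibly infinite, with morphisms of symmetry-restricted graphs to both $G$ and $G'$), then they have a common finite covering (a finite symmetry-restricted graph for these data with morphisms of symmetry-restricted graphs to both $G$ and $G'$).
   Context: All graphs are connected. Combinatorially, a graph $G$ consists of a vertex set $V(G)$, a directed edge set $E(G)$, an involution $e\mapsto\bar e$ on $E(G)$, and maps $\partial_0,\partial_1\colon E(G)\to V(G)$ (tail and head) with $\partial_0\bar e=\partial_1 e$. In an ordinary graph $e\ne\bar e$; a graph of colors may in general also have edges with $k=\bar k$. A graph-homomorphism commutes with $\partial_0,\partial_1$ and the involution. A $C$-colored graph is a graph with a graph-homomorphism to the graph of colors $C$; homomorphisms of $C$-colored graphs preserve colors. An $i$-vertex is a vertex of color $i\in V(C)$; a $k$-edge is a directed edge of color $k\in E(C)$. For a vertex $v$, $\mathrm{star}(v)$ denotes the set of directed edges departing $v$ (edges with tail $v$). Data for symmetry-restricted graphs: a graph of colors $C$ and, for each $i\in V(C)$, a finite permutation group $\Delta_i$ (a finite group acting faithfully on a finite set) together with an indexing of the orbits of $\Delta_i$ by the edge-colors $k\in E(C)$ with $\partial_0 k=i$ (one orbit for each such $k$). A symmetry-restricted graph for these data is a $C$-colored graph $G$ together with, for each $i$-vertex $v$ of $G$ (for every $i$),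 a representation of $\Delta_i$ as a color-preserving permutation group on $\mathrm{star}(v)$; that is, an action of $\Delta_i$ on $\mathrm{star}(v)$ that is isomorphic, as a $\Delta_i$-set, to the given permutation representation of $\Delta_i$, with the orbit indexed by $k$ corresponding to the set of $k$-edges in $\mathrm{star}(v)$. If $\Delta$ is a group, a map $\phi\colon X\to Y$ of $\Delta$-sets is weakly equivariant if there is $\gamma\in\Delta$ such that $\phi(\delta x)=\gamma\delta\gamma^{-1}\phi(x)$ for all $x\in X$, $\delta\in\Delta$. A morphism $\phi\colon G\to G'$ of symmetry-restricted graphs is a colored graph homomorphism which restricts to a weakly equivariant bijection $\mathrm{star}(v)\to\mathrm{star}(\phi(v))$ for each vertex $v$ of $G$. Every morphism is a covering map, and "covering" of symmetry-restricted graphs means such a morphism. *)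

theory Defs
  imports
    "HOL-Algebra.Group_Action"
    "Graph_Theory.Digraph_Component"
    "Graph_Theory.Arc_Walk"
begin

record ('v, 'e) bar_graph =
  dg :: "('v, 'e) pre_digraph"
  bar :: "'e \<Rightarrow> 'e"

abbreviation star :: "('v, 'e, 'm) bar_graph_scheme \<Rightarrow> 'v \<Rightarrow> 'e set" where
  "star G v \<equiv> out_arcs (dg G) v"

text \<open>Graphs may have \<open>bar e = e\<close>, as permitted for graphs of colors; ordinary graphs may not.
  Connectedness includes being nonempty.\<close>

definition bgraph :: "('v, 'e, 'm) bar_graph_scheme \<Rightarrow> bool" where
  "bgraph G \<longleftrightarrow> wf_digraph (dg G) \<and> Digraph_Component.connected (dg G) \<and>
     (\<forall>e\<in>arcs (dg G). bar G e \<in> arcs (dg G) \<and> bar G (bar G e) = e \<and>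
        tail (dg G) (bar G e) = head (dg G) e)"

definition ordinary_graph :: "('v, 'e, 'm) bar_graph_scheme \<Rightarrow> bool" where
  "ordinary_graph G \<longleftrightarrow> bgraph G \<and> (\<forall>e\<in>arcs (dg G). bar G e \<noteq> e)"

definition finite_graph :: "('v, 'e, 'm) bar_graph_scheme \<Rightarrow> bool" where
  "finite_graph G \<longleftrightarrow> finite (verts (dg G)) \<and> finite (arcs (dg G))"

definition reduced_walk :: "('v, 'e, 'm) bar_graph_scheme \<Rightarrow> 'e awalk \<Rightarrow> bool" where
  "reduced_walk G p \<longleftrightarrow> successively (\<lambda>e e'. e' \<noteq> bar G e) p"

text \<open>The library's \<open>tree\<close> counts a walk \<open>[e, bar e]\<close> as a cycle, so it does not apply here.
  Edges with \<open>bar e = e\<close> are loops, hence do not occur in a tree.\<close>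

definition tree_graph :: "('v, 'e, 'm) bar_graph_scheme \<Rightarrow> bool" where
  "tree_graph G \<longleftrightarrow> bgraph G \<and>
     \<not> (\<exists>u p. pre_digraph.awalk (dg G) u p u \<and> p \<noteq> [] \<and> reduced_walk G p)"

definition graph_hom ::
  "('v, 'e, 'm) bar_graph_scheme \<Rightarrow> ('w, 'f, 'n) bar_graph_scheme \<Rightarrow> ('v \<Rightarrow> 'w) \<Rightarrow> ('e \<Rightarrow> 'f) \<Rightarrow> bool"
where
  "graph_hom G H fv fe \<longleftrightarrow>
     (\<forall>v\<in>verts (dg G). fv v \<in> verts (dg H)) \<and>
     (\<forall>e\<in>arcs (dg G). fe e \<in> arcs (dg H) \<and>
        tail (dg H) (fe e) = fv (tail (dg G) e) \<and>
        head (dg H) (fe e) = fv (head (dg G) e) \<and>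
        fe (bar G e) = bar H (fe e))"

text \<open>For a color \<open>i\<close>, the group \<open>grp D i\<close> acts on the set \<open>pts D i\<close> via \<open>perm D i\<close>; the orbit
  indexed by an edge-color \<open>k\<close> departing \<open>i\<close> is \<open>orb D k\<close>.\<close>

record ('i, 'k, 'g, 'x) sym_data =
  grp :: "'i \<Rightarrow> 'g monoid"
  pts :: "'i \<Rightarrow> 'x set"
  perm :: "'i \<Rightarrow> 'g \<Rightarrow> 'x \<Rightarrow> 'x"
  orb :: "'k \<Rightarrow> 'x set"

definition symmetry_data :: "('i, 'k) bar_graph \<Rightarrow> ('i, 'k, 'g, 'x) sym_data \<Rightarrow> bool" where
  "symmetry_data C D \<longleftrightarrow> (\<forall>i\<in>verts (dg C).
     finite (carrier (grp D i)) \<and> finite (pts D i) \<and>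
     faithful_action (grp D i) (pts D i) (perm D i) \<and>
     bij_betw (orb D) (star C i) (orbits (grp D i) (pts D i) (perm D i)))"

record ('v, 'e, 'i, 'k, 'g) sr_graph = "('v, 'e) bar_graph" +
  vcol :: "'v \<Rightarrow> 'i"
  ecol :: "'e \<Rightarrow> 'k"
  act :: "'v \<Rightarrow> 'g \<Rightarrow> 'e \<Rightarrow> 'e"

definition symmetry_restricted_graph ::
  "('i, 'k) bar_graph \<Rightarrow> ('i, 'k, 'g, 'x) sym_data \<Rightarrow> ('v, 'e, 'i, 'k, 'g) sr_graph \<Rightarrow> bool"
where
  "symmetry_restricted_graph C D G \<longleftrightarrow>
     ordinary_graph G \<and> graph_hom G C (vcol G) (ecol G) \<and>
     (\<forall>v\<in>verts (dg G). let i = vcol G v in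
        group_action (grp D i) (star G v) (act G v) \<and>
        (\<exists>h. bij_betw h (pts D i) (star G v) \<and>
          (\<forall>\<delta>\<in>carrier (grp D i). \<forall>x\<in>pts D i. h (perm D i \<delta> x) = act G v \<delta> (h x)) \<and>
          (\<forall>k\<in>star C i. h ` orb D k = {e \<in> star G v. ecol G e = k})))"

definition weakly_equivariant ::
  "'g monoid \<Rightarrow> 'a set \<Rightarrow> ('g \<Rightarrow> 'a \<Rightarrow> 'a) \<Rightarrow> ('g \<Rightarrow> 'b \<Rightarrow> 'b) \<Rightarrow> ('a \<Rightarrow> 'b) \<Rightarrow> bool"
where
  "weakly_equivariant \<Delta> X a b f \<longleftrightarrow> (\<exists>\<gamma>\<in>carrier \<Delta>. \<forall>x\<in>X. \<forall>\<delta>\<in>carrier \<Delta>.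
     f (a \<delta> x) = b (\<gamma> \<otimes>\<^bsub>\<Delta>\<^esub> \<delta> \<otimes>\<^bsub>\<Delta>\<^esub> inv\<^bsub>\<Delta>\<^esub> \<gamma>) (f x))"

definition sr_morphism ::
  "('i, 'k, 'g, 'x) sym_data \<Rightarrow> ('v, 'e, 'i, 'k, 'g) sr_graph \<Rightarrow> ('w, 'f, 'i, 'k, 'g) sr_graph \<Rightarrow>
     ('v \<Rightarrow> 'w) \<Rightarrow> ('e \<Rightarrow> 'f) \<Rightarrow> bool"
where
  "sr_morphism D G H fv fe \<longleftrightarrow>
     graph_hom G H fv fe \<and>
     (\<forall>v\<in>verts (dg G). vcol H (fv v) = vcol G v) \<and>
     (\<forall>e\<in>arcs (dg G). ecol H (fe e) = ecol G e) \<and>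
     (\<forall>v\<in>verts (dg G). bij_betw fe (star G v) (star H (fv v)) \<and>
        weakly_equivariant (grp D (vcol G v)) (star G v) (act G v) (act H (fv v)) fe)"

definition common_covering ::
  "('i, 'k) bar_graph \<Rightarrow> ('i, 'k, 'g, 'x) sym_data \<Rightarrow> ('u, 'd, 'i, 'k, 'g) sr_graph \<Rightarrow>
     ('v, 'e, 'i, 'k, 'g) sr_graph \<Rightarrow> ('w, 'f, 'i, 'k, 'g) sr_graph \<Rightarrow> bool"
where
  "common_covering C D K G G' \<longleftrightarrow> symmetry_restricted_graph C D K \<and>
     (\<exists>fv fe. sr_morphism D K G fv fe) \<and> (\<exists>fv fe. sr_morphism D K G' fv fe)"

end

theory Submission
  imports Defs
begin

text \<open>Identify every star of \<open>G\<close> and \<open>G'\<close> with the model \<open>pts D i\<close>. An element \<open>\<delta>\<close> of \<open>grp D i\<close> then gives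
  a weakly equivariant bijection from the star of any \<open>i\<close>-vertex \<open>v\<close> of \<open>G\<close> to that of any
  \<open>i\<close>-vertex \<open>v'\<close> of \<open>G'\<close>, and the covering has \<open>a\<^sub>i\<close> vertices over each triple \<open>(v, v', \<delta>)\<close>. By
  orbit-stabilizer the number of them carrying a given \<open>k\<close>-edge \<open>e\<close> to a given \<open>k\<close>-edge \<open>e'\<close>
  is \<open>N\<^sub>k = a\<^sub>i |grp D i| / |orb D k|\<close>. If \<open>G\<close> has \<open>n\<^sub>i\<close> \<open>i\<close>-vertices and \<open>m\<^sub>k = n\<^sub>i |orb D k|\<close> \<open>k\<close>-edges,
  then \<open>a\<^sub>i = s / (n\<^sub>i |grp D i|)\<close> gives \<open>N\<^sub>k = s / m\<^sub>k\<close>, which is invariant under reversing \<open>k\<close>. Hence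
  the \<open>N\<^sub>k\<close> vertices at the tail of \<open>(e, e')\<close> can be matched with those at the tail of the reversed
  pair. A component of the resulting finite graph covers both, and its star actions are pulled
  back from \<open>G\<close>.\<close>

subsection \<open>Coverings of graphs\<close>

text \<open>Connectedness is left out because the product graph built below may be disconnected; it
  is restored at the end by passing to a component.\<close>

definition bar_digraph :: "('v, 'e, 'm) bar_graph_scheme \<Rightarrow> bool" where
  "bar_digraph G \<longleftrightarrow> wf_digraph (dg G) \<and>
     (\<forall>e\<in>arcs (dg G). bar G e \<in> arcs (dg G) \<and> bar G (bar G e) = e \<and>
        tail (dg G) (bar G e) = head (dg G) e)"

lemma bgraph_iff: "bgraph G \<longleftrightarrow> bar_digraph G \<and> Digraph_Component.connected (dg G)"
  by (auto simp: bgraph_def bar_digraph_def)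

lemma bar_digraphD:
  assumes "bar_digraph G" and "e \<in> arcs (dg G)"
  shows "bar G e \<in> arcs (dg G)" "bar G (bar G e) = e" "tail (dg G) (bar G e) = head (dg G) e"
    "head (dg G) (bar G e) = tail (dg G) e"
    "tail (dg G) e \<in> verts (dg G)" "head (dg G) e \<in> verts (dg G)"
  using assms by (auto simp: bar_digraph_def wf_digraph_def) metis

lemma symmetric_bar_digraph:
  assumes "bar_digraph G" shows "symmetric (dg G)"
  unfolding symmetric_conv using bar_digraphD[OF assms] by metis

text \<open>Reversing arcs by \<open>bar\<close> makes the digraph symmetric, so every vertex also
  reaches \<open>z\<close>, and any two vertices are joined through \<open>z\<close>.\<close>

lemma bgraphI:
  assumes G: "bar_digraph G" and z: "z \<in> verts (dg G)"
    and reach: "\<And>v. v \<in> verts (dg G) \<Longrightarrow> z \<rightarrow>\<^sup>*\<^bsub>dg G\<^esub> v"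
  shows "bgraph G"
proof -
  interpret wf_digraph "dg G" using G by (simp add: bar_digraph_def)
  have sym: "symmetric (dg G)" by (rule symmetric_bar_digraph[OF G])
  have "u \<rightarrow>\<^sup>*\<^bsub>dg G\<^esub> v" if "u \<in> verts (dg G)" "v \<in> verts (dg G)" for u v
    using symmetric_reachable[OF sym reach[OF that(1)]] reach[OF that(2)] by (rule reachable_trans)
  then show ?thesis using z
    by (auto simp: bgraph_iff G connected_def strongly_connected_def
        intro!: reachable_mk_symmetricI)
qed

text \<open>This is only the graph part of a morphism. Colors and star actions are added afterwards,
  by pulling them back along the covering.\<close>

definition graph_covering ::
  "('v, 'e, 'm) bar_graph_scheme \<Rightarrow> ('w, 'f, 'n) bar_graph_scheme \<Rightarrow> ('v \<Rightarrow> 'w) \<Rightarrow> ('e \<Rightarrow> 'f) \<Rightarrow> bool"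
where
  "graph_covering G H fv fe \<longleftrightarrow> graph_hom G H fv fe \<and>
     (\<forall>v\<in>verts (dg G). bij_betw fe (star G v) (star H (fv v)))"

lemma graph_hom_comp:
  assumes "graph_hom G H fv fe" and "graph_hom H K gv ge"
  shows "graph_hom G K (gv \<circ> fv) (ge \<circ> fe)"
  using assms by (simp add: graph_hom_def)

lemma graph_covering_comp:
  assumes "graph_covering G H fv fe" and "graph_covering H K gv ge"
  shows "graph_covering G K (gv \<circ> fv) (ge \<circ> fe)"
proof -
  have "bij_betw (ge \<circ> fe) (star G v) (star K (gv (fv v)))" if "v \<in> verts (dg G)" for v
    using assms that by (intro bij_betw_trans) (auto simp: graph_covering_def graph_hom_def)
  then show ?thesis
    using assms by (auto simp: graph_covering_def intro: graph_hom_comp)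
qed

text \<open>\<open>N\<close> is the component of \<open>z\<close>, renumbered by natural numbers so
  that its type does not depend on \<open>B\<close>. Its inclusion is a covering because a component
  contains every arc departing any of its vertices.\<close>

lemma finite_component:
  fixes B :: "('v, 'e, 'm) bar_graph_scheme"
  assumes B: "bar_digraph B" and fin: "finite_graph B" and z: "z \<in> verts (dg B)"
  obtains N :: "(nat, nat) bar_graph" and f g
  where "bgraph N" "finite_graph N" "graph_covering N B f g"
proof -
  interpret wf_digraph "dg B" using B by (simp add: bar_digraph_def)
  note BD = bar_digraphD[OF B]
  \<comment> \<open>Directed reachability already yields the whole component, since every arc has a
    reverse. An arc is kept as soon as its tail is in \<open>R\<close>; its head and its reverse
    then follow.\<close>
  define R where "R = {v. z \<rightarrow>\<^sup>*\<^bsub>dg B\<^esub> v}"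
  define A where "A = {e \<in> arcs (dg B). tail (dg B) e \<in> R}"
  have R_sub: "R \<subseteq> verts (dg B)"
    unfolding R_def using reachable_in_verts(2) by blast
  have finR: "finite R" and finA: "finite A"
    using fin R_sub by (auto simp: finite_graph_def A_def intro: finite_subset)
  have head_R: "head (dg B) e \<in> R" if "e \<in> A" for e
  proof -
    have "tail (dg B) e \<rightarrow>\<^bsub>dg B\<^esub> head (dg B) e"
      using that by (auto simp: A_def intro: dominatesI simp: arc_to_ends_def)
    then show ?thesis using that by (auto simp: A_def R_def intro: reachable_adj_trans)
  qed
  have bar_A: "bar B e \<in> A" if "e \<in> A" for e
    using that BD head_R by (auto simp: A_def)
  obtain f where f: "bij_betw f {0..<card R} R"
    using ex_bij_betw_nat_finite[OF finR] by blast
  obtain g where g: "bij_betw g {0..<card A} A"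
    using ex_bij_betw_nat_finite[OF finA] by blast
  define f' where "f' = inv_into {0..<card R} f"
  define g' where "g' = inv_into {0..<card A} g"
  have f': "f' v \<in> {0..<card R}" "f (f' v) = v" if "v \<in> R" for v
    using f that by (auto simp: f'_def bij_betw_def intro!: inv_into_into f_inv_into_f
        simp del: atLeastLessThan_iff)
  have f'f: "f' (f n) = n" if "n < card R" for n
    using f that by (auto simp: f'_def bij_betw_def)
  have g': "g' e \<in> {0..<card A}" "g (g' e) = e" if "e \<in> A" for e
    using g that by (auto simp: g'_def bij_betw_def intro!: inv_into_into f_inv_into_f
        simp del: atLeastLessThan_iff)
  have g'g: "g' (g n) = n" if "n < card A" for n
    using g that by (auto simp: g'_def bij_betw_def)
  have fR: "f n \<in> R" if "n < card R" for n using f that by (auto simp: bij_betw_def)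
  have gA: "g n \<in> A" if "n < card A" for n using g that by (auto simp: bij_betw_def)
  define N :: "(nat, nat) bar_graph" where
    "N = \<lparr>dg = \<lparr>verts = {0..<card R}, arcs = {0..<card A},
        tail = \<lambda>n. f' (tail (dg B) (g n)), head = \<lambda>n. f' (head (dg B) (g n))\<rparr>,
      bar = \<lambda>n. g' (bar B (g n))\<rparr>"
  have A_sub: "A \<subseteq> arcs (dg B)" by (auto simp: A_def)
  have tail_R: "tail (dg B) e \<in> R" if "e \<in> A" for e using that by (simp add: A_def)
  have BA: "bar B (bar B e) = e" "tail (dg B) (bar B e) = head (dg B) e"
    "head (dg B) (bar B e) = tail (dg B) e" if "e \<in> A" for e
    using that BD by (auto simp: A_def)
  have N: "bar_digraph N"
    using f' g' g'g gA bar_A head_R tail_R BA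
    by (auto simp: bar_digraph_def N_def wf_digraph_def)
  have "graph_hom N B f g"
    using f' g' gA fR bar_A head_R tail_R R_sub A_sub
    by (auto simp: graph_hom_def N_def)
  moreover have "bij_betw g (star N n) (star B (f n))" if "n \<in> verts (dg N)" for n
  proof (rule bij_betw_byWitness[where f' = g'])
    show "\<forall>e\<in>star N n. g' (g e) = e" using g'g by (auto simp: N_def)
    show "\<forall>e\<in>star B (f n). g (g' e) = e"
      using g' fR that by (auto simp: N_def A_def)
    show "g ` star N n \<subseteq> star B (f n)"
      using gA f' tail_R subsetD[OF A_sub gA] by (auto simp: N_def)
    show "g' ` star B (f n) \<subseteq> star N n"
      using g' f'f fR that by (auto simp: N_def A_def)
  qed
  ultimately have cov: "graph_covering N B f g" by (simp add: graph_covering_def)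
  have "bgraph N"
  proof (rule bgraphI[OF N])
    have zR: "z \<in> R" using z by (simp add: R_def)
    then show "f' z \<in> verts (dg N)" using f' by (simp add: N_def)
    interpret N: wf_digraph "dg N" using N by (simp add: bar_digraph_def)
    have step: "f' z \<rightarrow>\<^sup>*\<^bsub>dg N\<^esub> f' w" if "z \<rightarrow>\<^sup>*\<^bsub>dg B\<^esub> w" for w
      using that
    proof (induction rule: reachable_induct)
      case base
      have "f' z \<in> verts (dg N)" using f' zR by (simp add: N_def)
      then show ?case by (rule N.reachable_refl)
    next
      case (step x y)
      then obtain e where e: "e \<in> arcs (dg B)" "tail (dg B) e = x" "head (dg B) e = y"
        by (auto simp: arcs_ends_def arc_to_ends_def)
      then have "e \<in> A" using step by (auto simp: A_def R_def)
      then have "f' x \<rightarrow>\<^bsub>dg N\<^esub> f' y"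
        using e g' by (intro N.dominatesI[where a = "g' e"]) (auto simp: N_def arc_to_ends_def)
      then show ?case using step.IH by (rule N.reachable_adj_trans[rotated])
    qed
    show "f' z \<rightarrow>\<^sup>*\<^bsub>dg N\<^esub> n" if "n \<in> verts (dg N)" for n
      using step[of "f n"] fR[of n] f'f[of n] that by (auto simp: N_def R_def)
  qed
  moreover have "finite_graph N" by (simp add: N_def finite_graph_def)
  ultimately show thesis using cov by (rule that)
qed

subsection \<open>Pulling back the star actions\<close>

text \<open>The action at \<open>v\<close> is that of \<open>G\<close> at \<open>fv v\<close>,
  conjugated by the star bijection. The restriction to \<open>star N v\<close> makes each
  permutation extensional, as membership in \<open>BijGroup\<close> demands.\<close>

definition pullback ::
  "('w, 'f, 'i, 'k, 'g) sr_graph \<Rightarrow> ('v, 'e) bar_graph \<Rightarrow> ('v \<Rightarrow> 'w) \<Rightarrow> ('e \<Rightarrow> 'f) \<Rightarrow>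
     ('v, 'e, 'i, 'k, 'g) sr_graph" where
  "pullback G N fv fe = \<lparr>dg = dg N, bar = bar N, vcol = vcol G \<circ> fv, ecol = ecol G \<circ> fe,
     act = \<lambda>v \<delta>. \<lambda>e\<in>star N v. inv_into (star N v) fe (act G (fv v) \<delta> (fe e))\<rparr>"

lemma pullback_simps [simp]:
  "dg (pullback G N fv fe) = dg N" "bar (pullback G N fv fe) = bar N"
  "vcol (pullback G N fv fe) = vcol G \<circ> fv" "ecol (pullback G N fv fe) = ecol G \<circ> fe"
  by (simp_all add: pullback_def)

text \<open>Conjugation by \<open>h\<close> carries permutations of \<open>F\<close> to permutations
  of \<open>E\<close> and respects products. The second claim says that \<open>h\<close> becomes
  strictly equivariant.\<close>

lemma group_action_transport:
  assumes "group_action \<Delta> F a" and h: "bij_betw h E F"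
  shows "group_action \<Delta> E (\<lambda>\<delta>. \<lambda>x\<in>E. inv_into E h (a \<delta> (h x)))"
    and "\<And>\<delta> x. \<delta> \<in> carrier \<Delta> \<Longrightarrow> x \<in> E \<Longrightarrow> h (inv_into E h (a \<delta> (h x))) = a \<delta> (h x)"
proof -
  interpret group_action \<Delta> F a by fact
  interpret group \<Delta> using group_hom group_hom.axioms(1) by blast
  have hE: "h x \<in> F" if "x \<in> E" for x using h that by (auto simp: bij_betw_def)
  have aF: "a \<delta> y \<in> F" if "\<delta> \<in> carrier \<Delta>" "y \<in> F" for \<delta> y
    using element_image that by blast
  have inv: "h (inv_into E h y) = y" "inv_into E h y \<in> E" if "y \<in> F" for y
    using h that by (auto simp: bij_betw_def intro: f_inv_into_f inv_into_into)
  show eq: "h (inv_into E h (a \<delta> (h x))) = a \<delta> (h x)" if "\<delta> \<in> carrier \<Delta>" "x \<in> E" for \<delta> x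
    using that inv aF hE by blast
  have bij: "(\<lambda>x\<in>E. inv_into E h (a \<delta> (h x))) \<in> Bij E" if "\<delta> \<in> carrier \<Delta>" for \<delta>
  proof -
    have "bij_betw (a \<delta>) F F" using bij_prop0[OF that] by (simp add: Bij_def)
    then have "bij_betw (inv_into E h \<circ> (a \<delta> \<circ> h)) E E"
      using h by (intro bij_betw_trans[OF _ bij_betw_inv_into[OF h]]) (rule bij_betw_trans)
    then show ?thesis by (auto simp: Bij_def cong: bij_betw_cong)
  qed
  show "group_action \<Delta> E (\<lambda>\<delta>. \<lambda>x\<in>E. inv_into E h (a \<delta> (h x)))"
  proof (unfold group_action_def, rule group_hom.intro)
    show "group_hom_axioms \<Delta> (BijGroup E) (\<lambda>\<delta>. \<lambda>x\<in>E. inv_into E h (a \<delta> (h x)))"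
    proof (unfold group_hom_axioms_def, rule homI)
      show "(\<lambda>x\<in>E. inv_into E h (a \<delta> (h x))) \<in> carrier (BijGroup E)"
        if "\<delta> \<in> carrier \<Delta>" for \<delta>
        using bij[OF that] by (simp add: BijGroup_def)
      show "(\<lambda>x\<in>E. inv_into E h (a (\<delta> \<otimes>\<^bsub>\<Delta>\<^esub> \<epsilon>) (h x))) =
          (\<lambda>x\<in>E. inv_into E h (a \<delta> (h x))) \<otimes>\<^bsub>BijGroup E\<^esub> (\<lambda>x\<in>E. inv_into E h (a \<epsilon> (h x)))"
        if "\<delta> \<in> carrier \<Delta>" "\<epsilon> \<in> carrier \<Delta>" for \<delta> \<epsilon>
        using bij[OF that(1)] bij[OF that(2)] that hE aF inv
        by (auto simp: BijGroup_def compose_def composition_rule restrict_def fun_eq_iff)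
    qed
  qed (rule is_group group_BijGroup)+
qed

text \<open>All conditions on the stars of \<open>N\<close> are read off in \<open>G\<close> through
  the bijections \<open>fe\<close>. The equivariance of \<open>fe\<close> is strict, so this
  covering will be a morphism with conjugating element \<open>\<one>\<close>.\<close>

lemma
  assumes G: "symmetry_restricted_graph C D G" and N: "bgraph N"
    and cov: "graph_covering N G fv fe"
  shows srg_pullback: "symmetry_restricted_graph C D (pullback G N fv fe)"
    and act_pullback: "\<And>v e \<delta>. v \<in> verts (dg N) \<Longrightarrow> e \<in> star N v \<Longrightarrow>
      \<delta> \<in> carrier (grp D (vcol G (fv v))) \<Longrightarrow>
      fe (act (pullback G N fv fe) v \<delta> e) = act G (fv v) \<delta> (fe e)"
proof -
  let ?P = "pullback G N fv fe"
  have hom: "graph_hom N G fv fe" and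
    bij: "\<And>v. v \<in> verts (dg N) \<Longrightarrow> bij_betw fe (star N v) (star G (fv v))"
    using cov by (auto simp: graph_covering_def)
  have fvG: "fv v \<in> verts (dg G)" if "v \<in> verts (dg N)" for v
    using hom that by (simp add: graph_hom_def)
  have actG: "group_action (grp D (vcol G v)) (star G v) (act G v)" if "v \<in> verts (dg G)" for v
    using G that by (simp add: symmetry_restricted_graph_def Let_def)
  show act: "fe (act ?P v \<delta> e) = act G (fv v) \<delta> (fe e)"
    if "v \<in> verts (dg N)" "e \<in> star N v" "\<delta> \<in> carrier (grp D (vcol G (fv v)))" for v e \<delta>
    using group_action_transport(2)[OF actG[OF fvG] bij] that
    by (simp add: pullback_def del: in_out_arcs_conv)
  \<comment> \<open>An edge of \<open>N\<close> equal to its own reverse would map to such an edge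
    of \<open>G\<close>, which is ordinary.\<close>
  have "bar N e \<noteq> e" if e: "e \<in> arcs (dg N)" for e
  proof -
    have "fe e \<in> arcs (dg G)" "fe (bar N e) = bar G (fe e)"
      using hom e by (simp_all add: graph_hom_def)
    moreover have "ordinary_graph G" using G by (simp add: symmetry_restricted_graph_def)
    ultimately show ?thesis by (metis ordinary_graph_def)
  qed
  then have ord: "ordinary_graph ?P"
    using N by (simp add: ordinary_graph_def bgraph_def)
  have homC: "graph_hom ?P C (vcol ?P) (ecol ?P)"
  proof -
    have "graph_hom G C (vcol G) (ecol G)" using G by (simp add: symmetry_restricted_graph_def)
    then have "graph_hom N C (vcol G \<circ> fv) (ecol G \<circ> fe)" by (rule graph_hom_comp[OF hom])
    then show ?thesis by (simp only: graph_hom_def pullback_simps)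
  qed
  have "let i = vcol ?P v in group_action (grp D i) (star ?P v) (act ?P v) \<and>
        (\<exists>h. bij_betw h (pts D i) (star ?P v) \<and>
          (\<forall>\<delta>\<in>carrier (grp D i). \<forall>x\<in>pts D i. h (perm D i \<delta> x) = act ?P v \<delta> (h x)) \<and>
          (\<forall>k\<in>star C i. h ` orb D k = {e \<in> star ?P v. ecol ?P e = k}))"
    if v: "v \<in> verts (dg ?P)" for v
  proof -
    define i where "i = vcol G (fv v)"
    have v': "v \<in> verts (dg N)" using v by simp
    note b = bij[OF v']
    have ga: "group_action (grp D i) (star N v) (act ?P v)"
      using group_action_transport(1)[OF actG[OF fvG[OF v']] b] by (simp add: pullback_def i_def)
    interpret group_action "grp D i" "star N v" "act ?P v" by (rule ga)
    obtain h where h: "bij_betw h (pts D i) (star G (fv v))"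
      "\<And>\<delta> x. \<delta> \<in> carrier (grp D i) \<Longrightarrow> x \<in> pts D i \<Longrightarrow>
          h (perm D i \<delta> x) = act G (fv v) \<delta> (h x)"
      "\<And>k. k \<in> star C i \<Longrightarrow> h ` orb D k = {e \<in> star G (fv v). ecol G e = k}"
      using G fvG[OF v'] by (auto simp: symmetry_restricted_graph_def Let_def i_def)
    \<comment> \<open>The required model of the star at \<open>v\<close> is the model at
      \<open>fv v\<close>, carried back along the covering.\<close>
    let ?h = "inv_into (star N v) fe \<circ> h"
    have inv: "inv_into (star N v) fe (fe e) = e" if "e \<in> star N v" for e
      using b that by (simp only: bij_betw_def inv_into_f_f)
    have inv': "inv_into (star N v) fe e \<in> star N v" "fe (inv_into (star N v) fe e) = e"
      if "e \<in> star G (fv v)" for e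
      using b that by (simp_all only: bij_betw_def inv_into_into f_inv_into_f)
    have hs: "h x \<in> star G (fv v)" if "x \<in> pts D i" for x
      using h(1) that by (simp only: bij_betw_def) blast
    have "bij_betw ?h (pts D i) (star N v)"
      by (rule bij_betw_trans[OF h(1) bij_betw_inv_into[OF b]])
    moreover have "?h (perm D i \<delta> x) = act ?P v \<delta> (?h x)"
      if "\<delta> \<in> carrier (grp D i)" "x \<in> pts D i" for \<delta> x
    proof -
      \<comment> \<open>Since \<open>fe\<close> is injective on the star, it suffices to compare
        both sides after applying it.\<close>
      have "fe (act ?P v \<delta> (?h x)) = h (perm D i \<delta> x)"
        using act[OF v' inv'(1)[OF hs]] that inv'(2)[OF hs] h(2) by (simp add: i_def)
      moreover have "act ?P v \<delta> (?h x) \<in> star N v"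
        using element_image[OF that(1) inv'(1)[OF hs[OF that(2)]]] by simp
      ultimately show ?thesis using inv by (metis comp_apply)
    qed
    moreover have "?h ` orb D k = {e \<in> star N v. ecol G (fe e) = k}" if "k \<in> star C i" for k
    proof -
      have "?h ` orb D k = inv_into (star N v) fe ` {e \<in> star G (fv v). ecol G e = k}"
        unfolding h(3)[OF that, symmetric] by (simp only: image_comp)
      also have "\<dots> = {e \<in> star N v. ecol G (fe e) = k}"
      proof (intro equalityI subsetI)
        fix e assume e: "e \<in> {e \<in> star N v. ecol G (fe e) = k}"
        then have "fe e \<in> star G (fv v)" using b by (simp only: bij_betw_def) blast
        then show "e \<in> inv_into (star N v) fe ` {e \<in> star G (fv v). ecol G e = k}"
          using e inv[of e] by (intro image_eqI[where x = "fe e"]) auto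
      next
        fix e assume "e \<in> inv_into (star N v) fe ` {e \<in> star G (fv v). ecol G e = k}"
        then obtain y where y: "y \<in> star G (fv v)" "ecol G y = k" "e = inv_into (star N v) fe y"
          by (elim imageE CollectE conjE)
        show "e \<in> {e \<in> star N v. ecol G (fe e) = k}"
          using inv'[OF y(1)] y(2) by (simp only: y(3) mem_Collect_eq simp_thms)
      qed
      finally show ?thesis .
    qed
    ultimately have "\<exists>h. bij_betw h (pts D i) (star N v) \<and>
        (\<forall>\<delta>\<in>carrier (grp D i). \<forall>x\<in>pts D i. h (perm D i \<delta> x) = act ?P v \<delta> (h x)) \<and>
        (\<forall>k\<in>star C i. h ` orb D k = {e \<in> star N v. ecol G (fe e) = k})"
      by (intro exI[where x = ?h] conjI ballI)
    with ga show ?thesis by (simp only: Let_def i_def pullback_simps comp_apply simp_thms)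
  qed
  then show "symmetry_restricted_graph C D ?P"
    using ord homC by (simp only: symmetry_restricted_graph_def) blast
qed

subsection \<open>Orbits and charts of the stars\<close>

text \<open>The elements carrying \<open>x\<close> to \<open>y\<close> form a left coset
  \<open>h Stab(x)\<close>, where \<open>h\<close> is any one of them. The claim is therefore the
  orbit-stabilizer theorem.\<close>

lemma (in group_action) card_transporter:
  assumes x: "x \<in> E" and y: "y \<in> orbit G \<phi> x"
  shows "card (orbit G \<phi> x) * card {g \<in> carrier G. \<phi> g x = y} = order G"
proof -
  interpret group G using group_hom group_hom.axioms(1) by blast
  obtain h where h: "h \<in> carrier G" "\<phi> h x = y" using y by (auto simp: orbit_def)
  have hy: "\<phi> (inv h) y = x" using orbit_sym_aux[OF h(1) x h(2)] .
  have yE: "y \<in> E" using element_image h x by blast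
  have "bij_betw (\<lambda>g. h \<otimes> g) (stabilizer G \<phi> x) {g \<in> carrier G. \<phi> g x = y}"
    by (rule bij_betw_byWitness[where f' = "\<lambda>g. inv h \<otimes> g"])
      (use h hy x yE in \<open>auto simp: stabilizer_def composition_rule m_assoc[symmetric]\<close>)
  then have "card (stabilizer G \<phi> x) = card {g \<in> carrier G. \<phi> g x = y}"
    by (rule bij_betw_same_card)
  then show ?thesis using orbit_stabilizer_theorem[OF x] by simp
qed

lemma symmetry_restricted_graphD:
  assumes "symmetry_restricted_graph C D G"
  shows "bar_digraph G" "graph_hom G C (vcol G) (ecol G)"
    "\<And>v. v \<in> verts (dg G) \<Longrightarrow> vcol G v \<in> verts (dg C)"
    "\<And>e. e \<in> arcs (dg G) \<Longrightarrow> ecol G e \<in> arcs (dg C)"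
    "\<And>e. e \<in> arcs (dg G) \<Longrightarrow> tail (dg C) (ecol G e) = vcol G (tail (dg G) e)"
    "\<And>e. e \<in> arcs (dg G) \<Longrightarrow> ecol G (bar G e) = bar C (ecol G e)"
    "\<And>v. v \<in> verts (dg G) \<Longrightarrow> group_action (grp D (vcol G v)) (star G v) (act G v)"
  using assms
  by (simp_all add: symmetry_restricted_graph_def ordinary_graph_def bgraph_iff graph_hom_def Let_def)

text \<open>\<open>orb D k\<close> and the orbit of \<open>x\<close> are both members of the family
  of orbits and share \<open>x\<close>; distinct orbits are disjoint.\<close>

lemma orb_eq_orbit:
  assumes D: "symmetry_data C D" and i: "i \<in> verts (dg C)" and k: "k \<in> star C i"
    and x: "x \<in> orb D k"
  shows "x \<in> pts D i" "orbit (grp D i) (perm D i) x = orb D k"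
proof -
  have "faithful_action (grp D i) (pts D i) (perm D i)"
    and "bij_betw (orb D) (star C i) (orbits (grp D i) (pts D i) (perm D i))"
    using D i by (simp_all add: symmetry_data_def del: in_out_arcs_conv)
  then interpret group_action "grp D i" "pts D i" "perm D i"
    by (simp add: faithful_action_def)
  have orb: "orb D k \<in> orbits (grp D i) (pts D i) (perm D i)"
    using \<open>bij_betw (orb D) _ _\<close> k by (simp only: bij_betw_def) blast
  then show x': "x \<in> pts D i" using orbits_coverture x by blast
  then have "orbit (grp D i) (perm D i) x \<in> orbits (grp D i) (pts D i) (perm D i)"
    by (auto simp: orbits_def)
  then show "orbit (grp D i) (perm D i) x = orb D k"
    using disjoint_union[OF orb] x orbit_refl[OF x'] by blast
qed

text \<open>A chart goes from edges to points, opposite to the bijections in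
  \<open>symmetry_restricted_graph\<close>. Each edge lies in exactly one star, so a single function
  serves all vertices at once.\<close>

definition star_chart ::
  "('i, 'k) bar_graph \<Rightarrow> ('i, 'k, 'g, 'x) sym_data \<Rightarrow> ('v, 'e, 'i, 'k, 'g) sr_graph \<Rightarrow>
     ('e \<Rightarrow> 'x) \<Rightarrow> bool" where
  "star_chart C D G c \<longleftrightarrow> (\<forall>v\<in>verts (dg G). bij_betw c (star G v) (pts D (vcol G v)) \<and>
     (\<forall>e\<in>star G v.
        (\<forall>\<delta>\<in>carrier (grp D (vcol G v)). c (act G v \<delta> e) = perm D (vcol G v) \<delta> (c e)) \<and>
        (\<forall>k\<in>star C (vcol G v). c e \<in> orb D k \<longleftrightarrow> ecol G e = k)))"

text \<open>One model bijection is chosen per vertex, and an edge is sent to its preimage under the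
  bijection chosen at its tail.\<close>

lemma star_chart_exists:
  assumes D: "symmetry_data C D" and G: "symmetry_restricted_graph C D G"
  obtains c where "star_chart C D G c"
proof -
  define Q where "Q v h \<longleftrightarrow> bij_betw h (pts D (vcol G v)) (star G v) \<and>
          (\<forall>\<delta>\<in>carrier (grp D (vcol G v)). \<forall>x\<in>pts D (vcol G v).
             h (perm D (vcol G v) \<delta> x) = act G v \<delta> (h x)) \<and>
          (\<forall>k\<in>star C (vcol G v). h ` orb D k = {e \<in> star G v. ecol G e = k})" for v h
  define h where "h v = (SOME h. Q v h)" for v
  have "Q v (h v)" if "v \<in> verts (dg G)" for v
  proof -
    have "\<exists>h. Q v h"
      using G that unfolding symmetry_restricted_graph_def Let_def Q_def
      by (elim conjE) (drule (1) bspec, elim conjE)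
    then show ?thesis unfolding h_def by (rule someI_ex)
  qed
  then have h:
    "\<And>v. v \<in> verts (dg G) \<Longrightarrow> bij_betw (h v) (pts D (vcol G v)) (star G v)"
    "\<And>v \<delta> x. v \<in> verts (dg G) \<Longrightarrow> \<delta> \<in> carrier (grp D (vcol G v)) \<Longrightarrow> x \<in> pts D (vcol G v) \<Longrightarrow>
        h v (perm D (vcol G v) \<delta> x) = act G v \<delta> (h v x)"
    "\<And>v k. v \<in> verts (dg G) \<Longrightarrow> k \<in> star C (vcol G v) \<Longrightarrow>
        h v ` orb D k = {e \<in> star G v. ecol G e = k}"
    unfolding Q_def by simp_all
  define c where "c e = inv_into (pts D (vcol G (tail (dg G) e))) (h (tail (dg G) e)) e" for e
  have "bij_betw c (star G v) (pts D (vcol G v)) \<and>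
     (\<forall>e\<in>star G v.
        (\<forall>\<delta>\<in>carrier (grp D (vcol G v)). c (act G v \<delta> e) = perm D (vcol G v) \<delta> (c e)) \<and>
        (\<forall>k\<in>star C (vcol G v). c e \<in> orb D k \<longleftrightarrow> ecol G e = k))"
    if v: "v \<in> verts (dg G)" for v
  proof -
    define i where "i = vcol G v"
    have i: "i \<in> verts (dg C)" using symmetry_restricted_graphD(3)[OF G v] by (simp add: i_def)
    interpret star: group_action "grp D i" "star G v" "act G v"
      using symmetry_restricted_graphD(7)[OF G v] by (simp add: i_def)
    interpret faithful_action "grp D i" "pts D i" "perm D i"
      using D i by (simp add: symmetry_data_def)
    have bij: "bij_betw (h v) (pts D i) (star G v)" using h(1)[OF v] by (simp only: i_def)
    have c: "c e = inv_into (pts D i) (h v) e" if "e \<in> star G v" for e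
      using that by (simp add: c_def i_def)
    have hc: "h v (c e) = e" "c e \<in> pts D i" if "e \<in> star G v" for e
      using bij that unfolding c[OF that] bij_betw_def
      by (simp_all only: f_inv_into_f inv_into_into)
    have inj: "x = y" if "h v x = h v y" "x \<in> pts D i" "y \<in> pts D i" for x y
      using bij that by (simp only: bij_betw_def) (blast dest: inj_onD)
    have "bij_betw c (star G v) (pts D i)"
      using bij_betw_inv_into[OF bij] c by (simp only: cong: bij_betw_cong)
    moreover have "c (act G v \<delta> e) = perm D i \<delta> (c e)"
      if \<delta>: "\<delta> \<in> carrier (grp D i)" and e: "e \<in> star G v" for \<delta> e
    \<comment> \<open>Both sides are points of the model, so they are compared after applying the
      injective \<open>h v\<close>.\<close>
    proof (rule inj)
      have act: "act G v \<delta> e \<in> star G v" using star.element_image[OF \<delta> e refl] .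
      then show "c (act G v \<delta> e) \<in> pts D i" by (rule hc)
      show "perm D i \<delta> (c e) \<in> pts D i" using element_image[OF \<delta> hc(2)[OF e] refl] .
      show "h v (c (act G v \<delta> e)) = h v (perm D i \<delta> (c e))"
        using h(2)[OF v] \<delta> e hc[OF e] hc(1)[OF act] by (simp add: i_def)
    qed
    moreover have "c e \<in> orb D k \<longleftrightarrow> ecol G e = k" if e: "e \<in> star G v" and k: "k \<in> star C i" for e k
    proof -
      have img: "h v ` orb D k = {e \<in> star G v. ecol G e = k}"
        using h(3)[OF v] k by (simp only: i_def)
      show ?thesis
      proof
        assume "c e \<in> orb D k"
        then have "h v (c e) \<in> h v ` orb D k" by (rule imageI)
        then show "ecol G e = k" unfolding img hc(1)[OF e] by simp
      next
        assume "ecol G e = k"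
        then have "e \<in> h v ` orb D k" using e unfolding img by simp
        then obtain x where x: "x \<in> orb D k" "e = h v x" by blast
        then have "c e = x" using inj[of "c e" x] hc[OF e] orb_eq_orbit(1)[OF D i k x(1)] by simp
        then show "c e \<in> orb D k" using x by simp
      qed
    qed
    ultimately show ?thesis unfolding i_def by blast
  qed
  then have "star_chart C D G c" unfolding star_chart_def by blast
  then show thesis by (rule that)
qed

subsection \<open>The finite common covering\<close>

locale charted_pair =
  fixes C :: "('i, 'k) bar_graph"
    and D :: "('i, 'k, 'g, 'x) sym_data"
    and G :: "('v, 'e, 'i, 'k, 'g) sr_graph"
    and G' :: "('w, 'f, 'i, 'k, 'g) sr_graph"
    and c :: "'e \<Rightarrow> 'x"
    and c' :: "'f \<Rightarrow> 'x"
  assumes C: "bar_digraph C"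
    and D: "symmetry_data C D"
    and G: "symmetry_restricted_graph C D G" and finG: "finite_graph G"
    and G': "symmetry_restricted_graph C D G'" and finG': "finite_graph G'"
    and c: "star_chart C D G c"
    and c': "star_chart C D G' c'"
begin

lemmas GD = symmetry_restricted_graphD[OF G]
lemmas G'D = symmetry_restricted_graphD[OF G']
lemmas barG = bar_digraphD[OF GD(1)]
lemmas barG' = bar_digraphD[OF G'D(1)]

lemma fin: "finite (verts (dg G))" "finite (arcs (dg G))"
    "finite (verts (dg G'))" "finite (arcs (dg G'))"
  using finG finG' by (simp_all add: finite_graph_def)

lemma fin_grp: "i \<in> verts (dg C) \<Longrightarrow> finite (carrier (grp D i))"
  using D by (simp add: symmetry_data_def)

lemma group_action_pts:
  "i \<in> verts (dg C) \<Longrightarrow> group_action (grp D i) (pts D i) (perm D i)"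
  using D by (simp add: symmetry_data_def faithful_action_def)

lemma group_grp: "i \<in> verts (dg C) \<Longrightarrow> group (grp D i)"
  using group_action_pts[of i] group_action.group_hom group_hom.axioms(1) by blast

lemma chart:
  assumes "v \<in> verts (dg G)"
  shows "bij_betw c (star G v) (pts D (vcol G v))"
    "\<And>e. e \<in> star G v \<Longrightarrow> c e \<in> pts D (vcol G v)"
    "\<And>e \<delta>. e \<in> star G v \<Longrightarrow> \<delta> \<in> carrier (grp D (vcol G v)) \<Longrightarrow>
      c (act G v \<delta> e) = perm D (vcol G v) \<delta> (c e)"
    "\<And>e k. e \<in> star G v \<Longrightarrow> k \<in> star C (vcol G v) \<Longrightarrow> c e \<in> orb D k \<longleftrightarrow> ecol G e = k"
  using c assms bij_betwE by (fastforce simp: star_chart_def simp del: in_out_arcs_conv)+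

lemma chart':
  assumes "v \<in> verts (dg G')"
  shows "bij_betw c' (star G' v) (pts D (vcol G' v))"
    "\<And>e. e \<in> star G' v \<Longrightarrow> c' e \<in> pts D (vcol G' v)"
    "\<And>e \<delta>. e \<in> star G' v \<Longrightarrow> \<delta> \<in> carrier (grp D (vcol G' v)) \<Longrightarrow>
      c' (act G' v \<delta> e) = perm D (vcol G' v) \<delta> (c' e)"
    "\<And>e k. e \<in> star G' v \<Longrightarrow> k \<in> star C (vcol G' v) \<Longrightarrow> c' e \<in> orb D k \<longleftrightarrow> ecol G' e = k"
  using c' assms bij_betwE by (fastforce simp: star_chart_def simp del: in_out_arcs_conv)+

lemma same_ecol_imp_same_vcol:
  assumes "e \<in> arcs (dg G)" "e' \<in> arcs (dg G')" "ecol G e = ecol G' e'"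
  shows "vcol G (tail (dg G) e) = vcol G' (tail (dg G') e')"
  using GD(5)[OF assms(1)] G'D(5)[OF assms(2)] assms(3) by simp

section \<open>Vertex and edge counts, and the multiplicities they determine\<close>

definition num_verts :: "'i \<Rightarrow> nat" where
  "num_verts i = card {v \<in> verts (dg G). vcol G v = i}"

definition num_arcs :: "'k \<Rightarrow> nat" where
  "num_arcs k = card {e \<in> arcs (dg G). ecol G e = k}"

text \<open>This is the number \<open>s\<close>: a common multiple of
  \<open>n\<^sub>i |grp D i|\<close> over the colors \<open>i\<close> occurring in \<open>G\<close>.
  Indexing the product by the vertices of the finite graph \<open>G\<close> keeps it finite, at the
  price of repeated factors.\<close>

definition weight :: nat where
  "weight = (\<Prod>v\<in>verts (dg G). num_verts (vcol G v) * order (grp D (vcol G v)))"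

text \<open>This is \<open>a\<^sub>i\<close>. The division is exact for every color that occurs in
  \<open>G\<close>, by \<open>weight_eq\<close>.\<close>

definition vmult :: "'i \<Rightarrow> nat" where
  "vmult i = weight div (num_verts i * order (grp D i))"

text \<open>This is \<open>N\<^sub>k\<close>, given by the formula \<open>s / m\<^sub>k\<close> in
  which the symmetry under reversal of \<open>k\<close> is visible. Its meaning as a number of
  vertices is \<open>card_fibre\<close>.\<close>

definition amult :: "'k \<Rightarrow> nat" where
  "amult k = weight div num_arcs k"

lemma num_verts_order_pos:
  assumes "v \<in> verts (dg G)"
  shows "num_verts (vcol G v) * order (grp D (vcol G v)) > 0"
proof -
  have "num_verts (vcol G v) > 0"
    using assms fin(1) by (auto simp: num_verts_def card_gt_0_iff)
  moreover have "order (grp D (vcol G v)) > 0"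
    using monoid.order_gt_0_iff_finite[OF group.is_monoid[OF group_grp]] fin_grp GD(3)[OF assms]
    by blast
  ultimately show ?thesis by simp
qed

lemma weight_eq:
  assumes "v \<in> verts (dg G)"
  shows "num_verts (vcol G v) * order (grp D (vcol G v)) * vmult (vcol G v) = weight"
proof -
  have "num_verts (vcol G v) * order (grp D (vcol G v)) dvd weight"
    unfolding weight_def using fin(1) assms by (rule dvd_prodI)
  then show ?thesis by (simp add: vmult_def)
qed

text \<open>This provides at least one copy index over each vertex of \<open>G\<close>, from which a
  vertex of the product is later obtained.\<close>

lemma vmult_pos:
  assumes "v \<in> verts (dg G)"
  shows "vmult (vcol G v) > 0"
proof -
  have "weight > 0"
    unfolding weight_def using num_verts_order_pos by (intro prod_pos) blast
  then show ?thesis using weight_eq[OF assms] by (metis gr0I mult_0_right)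
qed

text \<open>The involution of \<open>G\<close> exchanges the two sets of edges. This is the balance
  that allows the two ends of a product arc to be matched.\<close>

lemma num_arcs_bar:
  assumes k: "k \<in> arcs (dg C)"
  shows "num_arcs (bar C k) = num_arcs k"
proof -
  have "bij_betw (bar G) {e \<in> arcs (dg G). ecol G e = bar C k} {e \<in> arcs (dg G). ecol G e = k}"
    using barG(1,2) GD(6) bar_digraphD(2)[OF C k]
    by (intro bij_betw_byWitness[where f' = "bar G"]) auto
  then show ?thesis unfolding num_arcs_def by (rule bij_betw_same_card)
qed

text \<open>The \<open>k\<close>-edges are partitioned by their tails, which all have color
  \<open>tail (dg C) k\<close>; at each such vertex the chart maps them bijectively onto
  \<open>orb D k\<close>.\<close>

lemma num_arcs_eq:
  assumes k: "k \<in> arcs (dg C)"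
  shows "num_arcs k = num_verts (tail (dg C) k) * card (orb D k)"
proof -
  let ?V = "{v \<in> verts (dg G). vcol G v = tail (dg C) k}"
  let ?E = "\<lambda>v. {e \<in> star G v. ecol G e = k}"
  have "card (?E v) = card (orb D k)" if v: "v \<in> ?V" for v
  proof -
    have vG: "v \<in> verts (dg G)" and kv: "k \<in> star C (vcol G v)" using v k by auto
    have i: "vcol G v \<in> verts (dg C)" by (rule GD(3)[OF vG])
    have "c ` ?E v = orb D k"
    proof (intro equalityI subsetI)
      fix x assume x: "x \<in> orb D k"
      then have "x \<in> c ` star G v"
        using orb_eq_orbit(1)[OF D i kv x] chart(1)[OF vG] by (simp add: bij_betw_def)
      then show "x \<in> c ` ?E v" using x chart(4)[OF vG _ kv] by blast
    qed (use chart(4)[OF vG _ kv] in blast)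
    moreover have "inj_on c (?E v)"
      using chart(1)[OF vG] unfolding bij_betw_def by (blast intro: inj_on_subset)
    ultimately show ?thesis by (metis card_image)
  qed
  moreover have "{e \<in> arcs (dg G). ecol G e = k} = (\<Union>v\<in>?V. ?E v)"
    using GD(5) barG(5) by auto
  moreover have "card (\<Union>v\<in>?V. ?E v) = (\<Sum>v\<in>?V. card (?E v))"
    using fin by (intro card_UN_disjoint) auto
  ultimately show ?thesis by (simp add: num_arcs_def num_verts_def)
qed

section \<open>Product vertices carrying one edge to another\<close>

text \<open>These are the product vertices, over the tails of \<open>e\<close> and
  \<open>e'\<close>, whose star identification carries \<open>e\<close> to \<open>e'\<close>. The
  tails are determined by the edges, so only the group element and the copy index are
  recorded.\<close>

definition fibre :: "'e \<Rightarrow> 'f \<Rightarrow> ('g \<times> nat) set" where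
  "fibre e e' = (let i = vcol G (tail (dg G) e) in
     {\<delta> \<in> carrier (grp D i). perm D i \<delta> (c e) = c' e'} \<times> {0..<vmult i})"

lemma mem_fibre:
  assumes "e \<in> star G v"
  shows "(\<delta>, t) \<in> fibre e e' \<longleftrightarrow> \<delta> \<in> carrier (grp D (vcol G v)) \<and>
    perm D (vcol G v) \<delta> (c e) = c' e' \<and> t < vmult (vcol G v)"
  using assms by (auto simp: fibre_def Let_def)

text \<open>With \<open>T\<close> the set of group elements carrying \<open>c e\<close> to
  \<open>c' e'\<close>, the fibre has \<open>|T| a\<^sub>i\<close> elements and
  \<open>|orb D k| |T| = |grp D i|\<close>. Multiplying by
  \<open>m\<^sub>k = n\<^sub>i |orb D k|\<close> gives
  \<open>n\<^sub>i |grp D i| a\<^sub>i = s\<close>, whatever the pair of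
  \<open>k\<close>-edges.\<close>

lemma
  assumes e: "e \<in> arcs (dg G)" and e': "e' \<in> arcs (dg G')" and col: "ecol G e = ecol G' e'"
  shows card_fibre: "card (fibre e e') = amult (ecol G e)"
    and finite_fibre: "finite (fibre e e')"
proof -
  define v v' where "v = tail (dg G) e" and "v' = tail (dg G') e'"
  define i where "i = vcol G v"
  let ?k = "ecol G e"
  have v: "v \<in> verts (dg G)" "e \<in> star G v" using e barG(5) by (auto simp: v_def)
  have v': "v' \<in> verts (dg G')" "e' \<in> star G' v'" using e' barG'(5) by (auto simp: v'_def)
  have i': "vcol G' v' = i" using same_ecol_imp_same_vcol[OF e e' col] by (simp add: i_def v_def v'_def)
  have i: "i \<in> verts (dg C)" using GD(3) v by (simp add: i_def)
  have k: "?k \<in> star C i" using GD(4,5) e by (simp add: i_def v_def)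
  have ce: "c e \<in> orb D ?k" using chart(4)[OF v, of ?k] k by (simp add: i_def)
  have ce': "c' e' \<in> orb D ?k" using chart'(4)[OF v', of ?k] k col by (simp add: i')
  interpret group_action "grp D i" "pts D i" "perm D i" by (rule group_action_pts[OF i])
  let ?T = "{\<delta> \<in> carrier (grp D i). perm D i \<delta> (c e) = c' e'}"
  note orb = orb_eq_orbit[OF D i k ce]
  have T: "card (orb D ?k) * card ?T = order (grp D i)"
    using card_transporter[OF orb(1), of "c' e'"] ce' by (simp only: orb(2))
  have P: "fibre e e' = ?T \<times> {0..<vmult i}" by (simp add: fibre_def i_def v_def Let_def)
  show "finite (fibre e e')" using fin_grp[OF i] by (simp add: P)
  have "num_arcs ?k * card (fibre e e') = weight"
    using weight_eq[OF v(1)] num_arcs_eq[of ?k] T k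
    by (simp add: P card_cartesian_product i_def[symmetric] ac_simps)
  \<comment> \<open>The edge \<open>e\<close> itself is counted, so the factor can be
    cancelled.\<close>
  moreover have "num_arcs ?k > 0"
    using e fin(2) by (auto simp: num_arcs_def card_gt_0_iff)
  ultimately show "card (fibre e e') = amult (ecol G e)"
    unfolding amult_def by (metis nonzero_mult_div_cancel_left less_irrefl)
qed

section \<open>The product graph\<close>

text \<open>The enumerations for a pair and for its reversed pair are chosen independently. Only
  their common index range matters: equal indices define the matching of the two fibres.\<close>

definition fibre_enum :: "'e \<Rightarrow> 'f \<Rightarrow> nat \<Rightarrow> 'g \<times> nat" where
  "fibre_enum e e' = (SOME b. bij_betw b {0..<amult (ecol G e)} (fibre e e'))"

lemma bij_fibre_enum:
  assumes "e \<in> arcs (dg G)" "e' \<in> arcs (dg G')" "ecol G e = ecol G' e'"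
  shows "bij_betw (fibre_enum e e') {0..<amult (ecol G e)} (fibre e e')"
  unfolding fibre_enum_def using ex_bij_betw_nat_finite[OF finite_fibre[OF assms]]
  unfolding card_fibre[OF assms] by (rule someI_ex)

text \<open>An arc is labelled by \<open>n < amult k\<close> rather than by the element of the fibre at its tail, so that
  reversal keeps the label; \<open>fibre_enum\<close> translates the label into the vertex at either end.\<close>

definition prod_graph :: "('v \<times> 'w \<times> 'g \<times> nat, 'e \<times> 'f \<times> nat) bar_graph" where
  "prod_graph = \<lparr>dg = \<lparr>
       verts = {(v, v', \<delta>, t). v \<in> verts (dg G) \<and> v' \<in> verts (dg G') \<and> vcol G v = vcol G' v' \<and>
         \<delta> \<in> carrier (grp D (vcol G v)) \<and> t < vmult (vcol G v)},
       arcs = {(e, e', n). e \<in> arcs (dg G) \<and> e' \<in> arcs (dg G') \<and> ecol G e = ecol G' e' \<and>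
         n < amult (ecol G e)},
       tail = \<lambda>(e, e', n). (tail (dg G) e, tail (dg G') e', fibre_enum e e' n),
       head = \<lambda>(e, e', n). (head (dg G) e, head (dg G') e', fibre_enum (bar G e) (bar G' e') n)\<rparr>,
     bar = \<lambda>(e, e', n). (bar G e, bar G' e', n)\<rparr>"

lemma mem_verts_prod_graph:
  "(v, v', \<delta>, t) \<in> verts (dg prod_graph) \<longleftrightarrow> v \<in> verts (dg G) \<and> v' \<in> verts (dg G') \<and>
     vcol G v = vcol G' v' \<and> \<delta> \<in> carrier (grp D (vcol G v)) \<and> t < vmult (vcol G v)"
  by (simp add: prod_graph_def)

lemma mem_arcs_prod_graph:
  "(e, e', n) \<in> arcs (dg prod_graph) \<longleftrightarrow> e \<in> arcs (dg G) \<and> e' \<in> arcs (dg G') \<and>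
     ecol G e = ecol G' e' \<and> n < amult (ecol G e)"
  by (simp add: prod_graph_def)

lemma prod_graph_simps:
  "tail (dg prod_graph) (e, e', n) = (tail (dg G) e, tail (dg G') e', fibre_enum e e' n)"
  "head (dg prod_graph) (e, e', n) = (head (dg G) e, head (dg G') e', fibre_enum (bar G e) (bar G' e') n)"
  "bar prod_graph (e, e', n) = (bar G e, bar G' e', n)"
  by (simp_all add: prod_graph_def)

lemma fibre_enum_mem:
  assumes "(e, e', n) \<in> arcs (dg prod_graph)"
  shows "fibre_enum e e' n \<in> fibre e e'"
  using bij_fibre_enum[of e e'] assms by (auto simp: mem_arcs_prod_graph bij_betw_def)

lemma tail_prod_graph:
  assumes "(e, e', n) \<in> arcs (dg prod_graph)"
  shows "tail (dg prod_graph) (e, e', n) \<in> verts (dg prod_graph)"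
proof -
  obtain \<delta> t where dt: "fibre_enum e e' n = (\<delta>, t)" by fastforce
  then have "(\<delta>, t) \<in> fibre e e'" using fibre_enum_mem[OF assms] by simp
  moreover have "e \<in> star G (tail (dg G) e)" using assms by (simp add: mem_arcs_prod_graph)
  ultimately show ?thesis
    using assms barG(5) barG'(5) same_ecol_imp_same_vcol[of e e']
    by (simp add: prod_graph_simps dt mem_verts_prod_graph mem_arcs_prod_graph mem_fibre)
qed

text \<open>The label \<open>n\<close> stays in range because \<open>num_arcs_bar\<close> makes
  \<open>amult\<close> invariant under reversal.\<close>

lemma bar_prod_graph:
  assumes "(e, e', n) \<in> arcs (dg prod_graph)"
  shows "(bar G e, bar G' e', n) \<in> arcs (dg prod_graph)"
proof -
  have e: "e \<in> arcs (dg G)" "e' \<in> arcs (dg G')" "ecol G e = ecol G' e'" "n < amult (ecol G e)"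
    using assms unfolding mem_arcs_prod_graph by blast+
  then have "amult (ecol G (bar G e)) = amult (ecol G e)"
    unfolding amult_def GD(6)[OF e(1)] num_arcs_bar[OF GD(4)[OF e(1)]] by simp
  then show ?thesis
    using e barG(1) barG'(1) GD(6) G'D(6) by (simp only: mem_arcs_prod_graph simp_thms)
qed

lemma bar_digraph_prod_graph: "bar_digraph prod_graph"
proof -
  have head: "head (dg prod_graph) (e, e', n) = tail (dg prod_graph) (bar G e, bar G' e', n)"
    if "(e, e', n) \<in> arcs (dg prod_graph)" for e e' n
    using that barG(3) barG'(3) by (simp add: prod_graph_simps mem_arcs_prod_graph)
  have "wf_digraph (dg prod_graph)"
    using tail_prod_graph head bar_prod_graph by (auto simp: wf_digraph_def)
  moreover have "bar prod_graph x \<in> arcs (dg prod_graph) \<and> bar prod_graph (bar prod_graph x) = x \<and>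
      tail (dg prod_graph) (bar prod_graph x) = head (dg prod_graph) x"
    if "x \<in> arcs (dg prod_graph)" for x
  proof -
    obtain e e' n where x: "x = (e, e', n)" by (cases x)
    have "bar G (bar G e) = e" "bar G' (bar G' e') = e'"
      using that barG(2) barG'(2) by (simp_all add: x mem_arcs_prod_graph)
    then show ?thesis
      using head bar_prod_graph that by (simp only: x prod_graph_simps(3) simp_thms)
  qed
  ultimately show ?thesis by (simp add: bar_digraph_def)
qed

lemma finite_prod_graph: "finite_graph prod_graph"
proof -
  have "verts (dg prod_graph) \<subseteq> verts (dg G) \<times> verts (dg G') \<times>
      (\<Union>v\<in>verts (dg G). carrier (grp D (vcol G v))) \<times> (\<Union>v\<in>verts (dg G). {0..<vmult (vcol G v)})"
    by (auto simp: prod_graph_def)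
  moreover have "arcs (dg prod_graph) \<subseteq> arcs (dg G) \<times> arcs (dg G') \<times>
      (\<Union>e\<in>arcs (dg G). {0..<amult (ecol G e)})"
    by (auto simp: prod_graph_def)
  ultimately show ?thesis
    using fin fin_grp GD(3) unfolding finite_graph_def
    by (auto elim!: finite_subset)
qed

section \<open>Stars of the product graph and the identifications they carry\<close>

text \<open>Read in the charts at \<open>v\<close> and \<open>v'\<close>, this map is the
  permutation \<delta> of the model.\<close>

definition star_iso :: "'v \<Rightarrow> 'w \<Rightarrow> 'g \<Rightarrow> 'e \<Rightarrow> 'f" where
  "star_iso v v' \<delta> e = inv_into (star G' v') c' (perm D (vcol G v) \<delta> (c e))"

context
  fixes v v' \<delta> t
  assumes w: "(v, v', \<delta>, t) \<in> verts (dg prod_graph)"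
begin

lemma wD: "v \<in> verts (dg G)" "v' \<in> verts (dg G')" "vcol G' v' = vcol G v"
  "\<delta> \<in> carrier (grp D (vcol G v))" "t < vmult (vcol G v)" "vcol G v \<in> verts (dg C)"
  using w GD(3)[of v] unfolding mem_verts_prod_graph by metis+

lemma bij_star_iso: "bij_betw (star_iso v v' \<delta>) (star G v) (star G' v')"
proof -
  interpret group_action "grp D (vcol G v)" "pts D (vcol G v)" "perm D (vcol G v)"
    by (rule group_action_pts[OF wD(6)])
  have "bij_betw (perm D (vcol G v) \<delta>) (pts D (vcol G v)) (pts D (vcol G v))"
    using bij_prop0[OF wD(4)] by (simp add: Bij_def)
  then have "bij_betw (inv_into (star G' v') c' \<circ> (perm D (vcol G v) \<delta> \<circ> c)) (star G v) (star G' v')"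
    using chart(1)[OF wD(1)] bij_betw_inv_into[OF chart'(1)[OF wD(2)]]
    unfolding wD(3) by (blast intro: bij_betw_trans)
  then show ?thesis by (simp only: star_iso_def[abs_def] comp_def)
qed

lemma star_iso_in: "e \<in> star G v \<Longrightarrow> star_iso v v' \<delta> e \<in> star G' v'"
  using bij_star_iso by (simp only: bij_betw_def) blast

lemma chart'_star_iso:
  assumes e: "e \<in> star G v"
  shows "c' (star_iso v v' \<delta> e) = perm D (vcol G v) \<delta> (c e)"
proof -
  have "perm D (vcol G v) \<delta> (c e) \<in> pts D (vcol G v)"
    using group_action.element_image[OF group_action_pts[OF wD(6)] wD(4) chart(2)[OF wD(1) e] refl] .
  then show ?thesis
    using chart'(1)[OF wD(2)] unfolding star_iso_def bij_betw_def wD(3)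
    by (simp only: f_inv_into_f)
qed

lemma star_iso_eqI:
  assumes "e \<in> star G v" "e' \<in> star G' v'" "perm D (vcol G v) \<delta> (c e) = c' e'"
  shows "star_iso v v' \<delta> e = e'"
  using chart'(1)[OF wD(2)] chart'_star_iso[OF assms(1)] star_iso_in[OF assms(1)] assms(2,3)
  unfolding bij_betw_def by (metis inj_onD)

text \<open>Applying \<delta> keeps a point within its orbit, and charts translate orbits into
  edge-colors.\<close>

lemma ecol_star_iso:
  assumes e: "e \<in> star G v"
  shows "ecol G' (star_iso v v' \<delta> e) = ecol G e"
proof -
  have k: "ecol G e \<in> star C (vcol G v)" using e GD(4,5) by auto
  have ce: "c e \<in> orb D (ecol G e)" using chart(4)[OF wD(1) e k] by simp
  have "perm D (vcol G v) \<delta> (c e) \<in> orbit (grp D (vcol G v)) (perm D (vcol G v)) (c e)"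
    using wD(4) by (auto simp: orbit_def)
  then have "c' (star_iso v v' \<delta> e) \<in> orb D (ecol G e)"
    using orb_eq_orbit(2)[OF D wD(6) k ce] by (simp only: chart'_star_iso[OF e])
  then show ?thesis
    using chart'(4)[OF wD(2) star_iso_in[OF e], of "ecol G e"] k by (simp only: wD(3))
qed

text \<open>The label of an arc departing the vertex enumerates (\<delta>, t), which therefore lies
  in the fibre of (e, e'). This forces \<delta> to carry \<open>e\<close> to \<open>e'\<close>, so
  the first coordinate determines the second.\<close>

lemma star_prod_graph_iff:
  "(e, e', n) \<in> star prod_graph (v, v', \<delta>, t) \<longleftrightarrow>
     e \<in> star G v \<and> e' = star_iso v v' \<delta> e \<and> n < amult (ecol G e) \<and> fibre_enum e e' n = (\<delta>, t)"
proof
  assume x: "(e, e', n) \<in> star prod_graph (v, v', \<delta>, t)"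
  then have a: "(e, e', n) \<in> arcs (dg prod_graph)" and e: "e \<in> star G v" "e' \<in> star G' v'"
    and n: "fibre_enum e e' n = (\<delta>, t)"
    by (auto simp: prod_graph_simps mem_arcs_prod_graph)
  have "(\<delta>, t) \<in> fibre e e'" using fibre_enum_mem[OF a] n by simp
  then have "star_iso v v' \<delta> e = e'" using mem_fibre[OF e(1)] by (intro star_iso_eqI[OF e]) simp
  then show "e \<in> star G v \<and> e' = star_iso v v' \<delta> e \<and> n < amult (ecol G e) \<and> fibre_enum e e' n = (\<delta>, t)"
    using e n a unfolding mem_arcs_prod_graph by blast
next
  assume "e \<in> star G v \<and> e' = star_iso v v' \<delta> e \<and> n < amult (ecol G e) \<and> fibre_enum e e' n = (\<delta>, t)"
  then show "(e, e', n) \<in> star prod_graph (v, v', \<delta>, t)"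
    using star_iso_in[of e] ecol_star_iso[of e]
    by (auto simp: prod_graph_simps mem_arcs_prod_graph)
qed

text \<open>Over an edge \<open>e\<close> of the star, the second coordinate must be its image under
  \<open>star_iso\<close>, and (\<delta>, t) lies in the fibre of that pair. As
  \<open>fibre_enum\<close> is a bijection, exactly one label fits.\<close>

lemma bij_fst_star: "bij_betw fst (star prod_graph (v, v', \<delta>, t)) (star G v)"
proof (rule bij_betw_imageI)
  show "inj_on fst (star prod_graph (v, v', \<delta>, t))"
  proof (rule inj_onI)
    fix x y assume x: "x \<in> star prod_graph (v, v', \<delta>, t)" and y: "y \<in> star prod_graph (v, v', \<delta>, t)"
      and "fst x = fst y"
    then obtain e e' n m where xy: "x = (e, e', n)" "y = (e, e', m)"
      by (cases x; cases y) (auto simp only: star_prod_graph_iff fst_conv)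
    have e: "e \<in> arcs (dg G)" "e' \<in> arcs (dg G')" "ecol G e = ecol G' e'"
      using x xy by (auto simp: mem_arcs_prod_graph)
    have "n = m"
      using x y unfolding xy star_prod_graph_iff
      by (intro inj_onD[OF bij_betw_imp_inj_on[OF bij_fibre_enum[OF e]]]) auto
    then show "x = y" by (simp add: xy)
  qed
  show "fst ` star prod_graph (v, v', \<delta>, t) = star G v"
  proof (intro equalityI subsetI)
    fix e assume e: "e \<in> star G v"
    let ?e' = "star_iso v v' \<delta> e"
    have "(\<delta>, t) \<in> fibre e ?e'" using mem_fibre[OF e] chart'_star_iso[OF e] wD by simp
    moreover have "bij_betw (fibre_enum e ?e') {0..<amult (ecol G e)} (fibre e ?e')"
      using e star_iso_in[OF e] ecol_star_iso[OF e] by (intro bij_fibre_enum) auto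
    ultimately obtain n where "n < amult (ecol G e)" "fibre_enum e ?e' n = (\<delta>, t)"
      by (force simp: bij_betw_def image_iff)
    then have "(e, ?e', n) \<in> star prod_graph (v, v', \<delta>, t)" using e by (simp only: star_prod_graph_iff simp_thms)
    then show "e \<in> fst ` star prod_graph (v, v', \<delta>, t)" by force
  next
    fix e assume "e \<in> fst ` star prod_graph (v, v', \<delta>, t)"
    then obtain e' n where "(e, e', n) \<in> star prod_graph (v, v', \<delta>, t)" by force
    then show "e \<in> star G v" by (simp only: star_prod_graph_iff)
  qed
qed

lemma snd_of_star:
  assumes "x \<in> star prod_graph (v, v', \<delta>, t)"
  shows "fst (snd x) = star_iso v v' \<delta> (fst x)"
  using assms by (cases x) (simp only: star_prod_graph_iff fst_conv snd_conv)

lemma bij_snd_star: "bij_betw (fst \<circ> snd) (star prod_graph (v, v', \<delta>, t)) (star G' v')"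
proof -
  have "bij_betw (star_iso v v' \<delta> \<circ> fst) (star prod_graph (v, v', \<delta>, t)) (star G' v')"
    by (rule bij_betw_trans[OF bij_fst_star bij_star_iso])
  then show ?thesis using snd_of_star by (simp only: comp_def cong: bij_betw_cong)
qed

text \<open>In the charts this is the identity \<delta>\<epsilon> =
  (\<delta>\<epsilon>\<delta>^-1)\<delta>, so the conjugating element is \<delta> itself.\<close>

lemma weakly_equivariant_star_iso:
  assumes e: "e \<in> star G v" and \<epsilon>: "\<epsilon> \<in> carrier (grp D (vcol G v))"
  shows "star_iso v v' \<delta> (act G v \<epsilon> e) =
    act G' v' (\<delta> \<otimes>\<^bsub>grp D (vcol G v)\<^esub> \<epsilon> \<otimes>\<^bsub>grp D (vcol G v)\<^esub> inv\<^bsub>grp D (vcol G v)\<^esub> \<delta>) (star_iso v v' \<delta> e)"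
proof (rule star_iso_eqI)
  let ?i = "vcol G v"
  interpret group_action "grp D ?i" "pts D ?i" "perm D ?i"
    by (rule group_action_pts[OF wD(6)])
  interpret group "grp D ?i" by (rule group_grp[OF wD(6)])
  let ?\<gamma> = "\<delta> \<otimes>\<^bsub>grp D ?i\<^esub> \<epsilon> \<otimes>\<^bsub>grp D ?i\<^esub> inv\<^bsub>grp D ?i\<^esub> \<delta>"
  note \<delta> = wD(4)
  have \<gamma>: "?\<gamma> \<in> carrier (grp D ?i)" using \<delta> \<epsilon> by simp
  note ce = chart(2)[OF wD(1) e]
  show "act G v \<epsilon> e \<in> star G v"
    using group_action.element_image[OF GD(7)[OF wD(1)] \<epsilon> e refl] .
  show "act G' v' ?\<gamma> (star_iso v v' \<delta> e) \<in> star G' v'"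
    using group_action.element_image[OF G'D(7)[OF wD(2)] _ star_iso_in[OF e] refl] \<gamma>
    by (simp only: wD(3))
  have "c' (act G' v' ?\<gamma> (star_iso v v' \<delta> e)) = perm D ?i ?\<gamma> (perm D ?i \<delta> (c e))"
    using chart'(3)[OF wD(2) star_iso_in[OF e]] \<gamma> chart'_star_iso[OF e] by (simp add: wD(3))
  also have "\<dots> = perm D ?i (?\<gamma> \<otimes>\<^bsub>grp D ?i\<^esub> \<delta>) (c e)"
    using composition_rule[OF ce \<gamma> \<delta>] by simp
  also have "?\<gamma> \<otimes>\<^bsub>grp D ?i\<^esub> \<delta> = \<delta> \<otimes>\<^bsub>grp D ?i\<^esub> \<epsilon>"
    using \<delta> \<epsilon> by (simp add: m_assoc)
  also have "perm D ?i \<dots> (c e) = perm D ?i \<delta> (c (act G v \<epsilon> e))"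
    using composition_rule[OF ce \<delta> \<epsilon>] chart(3)[OF wD(1) e \<epsilon>] by simp
  finally show "perm D ?i \<delta> (c (act G v \<epsilon> e)) = c' (act G' v' ?\<gamma> (star_iso v v' \<delta> e))" by simp
qed

end

section \<open>The two projections and the resulting morphisms\<close>

lemma covering_fst: "graph_covering prod_graph G fst fst"
proof -
  have "graph_hom prod_graph G fst fst"
    by (auto simp: graph_hom_def prod_graph_def)
  moreover have "bij_betw fst (star prod_graph w) (star G (fst w))"
    if "w \<in> verts (dg prod_graph)" for w
    using bij_fst_star that by (cases w) (simp only: fst_conv)
  ultimately show ?thesis by (simp add: graph_covering_def)
qed

lemma covering_snd: "graph_covering prod_graph G' (fst \<circ> snd) (fst \<circ> snd)"
proof -
  have "graph_hom prod_graph G' (fst \<circ> snd) (fst \<circ> snd)"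
    by (auto simp: graph_hom_def prod_graph_def)
  moreover have "bij_betw (fst \<circ> snd) (star prod_graph w) (star G' ((fst \<circ> snd) w))"
    if "w \<in> verts (dg prod_graph)" for w
    using bij_snd_star that by (cases w) (simp only: fst_conv snd_conv comp_apply)
  ultimately show ?thesis by (simp add: graph_covering_def)
qed

text \<open>A component of the product receives its colors and actions from \<open>G\<close>. The
  projection to \<open>G\<close> is then strictly equivariant, while the projection to
  \<open>G'\<close> differs from it on each star by \<open>star_iso\<close>, which is weakly
  equivariant.\<close>

lemma finite_common_covering:
  assumes u: "u \<in> verts (dg G)" and u': "u' \<in> verts (dg G')" and col: "vcol G u = vcol G' u'"
  shows "\<exists>H :: (nat, nat, 'i, 'k, 'g) sr_graph. finite_graph H \<and> common_covering C D H G G'"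
proof -
  \<comment> \<open>The matching colors of \<open>u\<close> and \<open>u'\<close> make the product
    nonempty; the group identity and copy index 0 select one vertex over the pair.\<close>
  have "(u, u', \<one>\<^bsub>grp D (vcol G u)\<^esub>, 0) \<in> verts (dg prod_graph)"
    using u u' col vmult_pos[OF u] group.is_monoid[OF group_grp[OF GD(3)[OF u]]]
    by (simp add: mem_verts_prod_graph monoid.one_closed)
  then obtain N :: "(nat, nat) bar_graph" and f g
    where N: "bgraph N" "finite_graph N" and cov: "graph_covering N prod_graph f g"
    by (rule finite_component[OF bar_digraph_prod_graph finite_prod_graph])
  define H where "H = pullback G N (fst \<circ> f) (fst \<circ> g)"
  note cov1 = graph_covering_comp[OF cov covering_fst]
  note cov2 = graph_covering_comp[OF cov covering_snd]
  have H: "symmetry_restricted_graph C D H"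
    unfolding H_def by (rule srg_pullback[OF G N(1) cov1])
  have act_H: "fst (g (act H n \<epsilon> e)) = act G (fst (f n)) \<epsilon> (fst (g e))"
    if "n \<in> verts (dg N)" "e \<in> star N n" "\<epsilon> \<in> carrier (grp D (vcol G (fst (f n))))" for n e \<epsilon>
    using act_pullback[OF G N(1) cov1] that by (simp add: H_def del: in_out_arcs_conv)
  have H_simps: "dg H = dg N" "vcol H n = vcol G (fst (f n))" "ecol H e = ecol G (fst (g e))" for n e
    by (simp_all add: H_def)
  have hom: "graph_hom H G (fst \<circ> f) (fst \<circ> g)"
    "graph_hom H G' (fst \<circ> snd \<circ> f) (fst \<circ> snd \<circ> g)"
    using cov1 cov2 by (simp_all add: H_def graph_covering_def graph_hom_def)
  have fN: "f n \<in> verts (dg prod_graph)" if "n \<in> verts (dg N)" for n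
    using cov that by (simp add: graph_covering_def graph_hom_def)
  have gN: "g e \<in> arcs (dg prod_graph)" if "e \<in> arcs (dg N)" for e
    using cov that by (simp add: graph_covering_def graph_hom_def)
  have gstar: "g e \<in> star prod_graph (f n)" if "n \<in> verts (dg N)" "e \<in> star N n" for n e
    using cov that by (auto simp: graph_covering_def graph_hom_def)
  have act_star: "act H n \<epsilon> e \<in> star N n"
    if "n \<in> verts (dg N)" "e \<in> star N n" "\<epsilon> \<in> carrier (grp D (vcol G (fst (f n))))" for n e \<epsilon>
    using group_action.element_image[OF symmetry_restricted_graphD(7)[OF H] _ _ refl, of n \<epsilon> e] that
    by (simp only: H_simps)
  have "weakly_equivariant (grp D (vcol H n)) (star H n) (act H n) (act G (fst (f n))) (fst \<circ> g)"
    if n: "n \<in> verts (dg N)" for n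
  proof -
    have "fst (f n) \<in> verts (dg G)"
      using fN[OF n] by (cases "f n") (simp add: mem_verts_prod_graph)
    then interpret group "grp D (vcol G (fst (f n)))" by (intro group_grp GD(3))
    \<comment> \<open>The conjugating element is the identity, since the action was pulled back
      along this very map.\<close>
    show ?thesis unfolding weakly_equivariant_def H_simps comp_apply
      using act_H[OF n] by (intro bexI[OF _ one_closed] ballI) (simp del: in_out_arcs_conv)
  qed
  then have "sr_morphism D H G (fst \<circ> f) (fst \<circ> g)"
    using hom(1) cov1 by (simp add: sr_morphism_def H_simps graph_covering_def)
  moreover have "sr_morphism D H G' (fst \<circ> snd \<circ> f) (fst \<circ> snd \<circ> g)"
  proof -
    have "vcol G' (fst (snd (f n))) = vcol G (fst (f n))" if "n \<in> verts (dg N)" for n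
      using fN[OF that] by (cases "f n") (simp add: mem_verts_prod_graph)
    moreover have "ecol G' (fst (snd (g e))) = ecol G (fst (g e))" if "e \<in> arcs (dg N)" for e
      using gN[OF that] by (cases "g e") (simp add: mem_arcs_prod_graph)
    moreover have "weakly_equivariant (grp D (vcol H n)) (star H n) (act H n)
        (act G' (fst (snd (f n)))) (fst \<circ> snd \<circ> g)"
      if n: "n \<in> verts (dg N)" for n
    proof -
      obtain v v' \<delta> t where fn: "f n = (v, v', \<delta>, t)" by (cases "f n")
      have w: "(v, v', \<delta>, t) \<in> verts (dg prod_graph)" using fN[OF n] by (simp only: fn)
      have snd_g: "fst (snd (g e)) = star_iso v v' \<delta> (fst (g e))" if "e \<in> star N n" for e
        using snd_of_star[OF w] gstar[OF n that] by (simp only: fn)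
      have fst_g: "fst (g e) \<in> star G v" if "e \<in> star N n" for e
        using bij_betwE[OF bij_fst_star[OF w]] gstar[OF n that] by (simp only: fn)
      have "fst (snd (g (act H n \<epsilon> e))) =
          act G' v' (\<delta> \<otimes>\<^bsub>grp D (vcol G v)\<^esub> \<epsilon> \<otimes>\<^bsub>grp D (vcol G v)\<^esub> inv\<^bsub>grp D (vcol G v)\<^esub> \<delta>)
            (fst (snd (g e)))"
        if e: "e \<in> star N n" and \<epsilon>: "\<epsilon> \<in> carrier (grp D (vcol G v))" for e \<epsilon>
      proof -
        have \<epsilon>': "\<epsilon> \<in> carrier (grp D (vcol G (fst (f n))))" using \<epsilon> by (simp add: fn)
        show ?thesis
          using weakly_equivariant_star_iso[OF w fst_g[OF e] \<epsilon>] snd_g[OF act_star[OF n e \<epsilon>']]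
            snd_g[OF e] act_H[OF n e \<epsilon>'] by (simp add: fn)
      qed
      \<comment> \<open>The conjugating element is the third coordinate \<delta> of the product
        vertex below \<open>n\<close>, so it may vary from vertex to vertex.\<close>
      then show ?thesis unfolding weakly_equivariant_def H_simps comp_apply fn fst_conv snd_conv
        by (intro bexI[OF _ wD(4)[OF w]] ballI)
    qed
    ultimately show ?thesis
      using hom(2) cov2 by (simp add: sr_morphism_def H_simps graph_covering_def)
  qed
  moreover have "finite_graph H" using N(2) by (simp add: finite_graph_def H_simps)
  ultimately show ?thesis using H unfolding common_covering_def by blast
qed

end

theorem theorem2p4:
  fixes C :: "('i, 'k) bar_graph"
    and D :: "('i, 'k, 'g, 'x) sym_data"
    and G :: "('v, 'e, 'i, 'k, 'g) sr_graph"
    and G' :: "('w, 'f, 'i, 'k, 'g) sr_graph"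
    and K :: "('u, 'd, 'i, 'k, 'g) sr_graph"
  assumes "tree_graph C"
    and "symmetry_data C D"
    and "symmetry_restricted_graph C D G" and "finite_graph G"
    and "symmetry_restricted_graph C D G'" and "finite_graph G'"
    and "common_covering C D K G G'"
  shows "\<exists>H :: (nat, nat, 'i, 'k, 'g) sr_graph.
    finite_graph H \<and> common_covering C D H G G'"
proof -
  obtain c where c: "star_chart C D G c" using star_chart_exists[OF assms(2,3)] .
  obtain c' where c': "star_chart C D G' c'" using star_chart_exists[OF assms(2,5)] .
  interpret charted_pair C D G G' c c'
    using assms c c' by unfold_locales (simp_all add: tree_graph_def bgraph_iff)
  obtain fv fe fv' fe' where K: "symmetry_restricted_graph C D K"
    and f: "sr_morphism D K G fv fe" "sr_morphism D K G' fv' fe'"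
    using assms(7) by (auto simp: common_covering_def)
  \<comment> \<open>Connectedness of \<open>K\<close> includes being nonempty. The images in
    \<open>G\<close> and \<open>G'\<close> of one vertex of \<open>K\<close> have the same color, as
    morphisms preserve colors.\<close>
  have "verts (dg K) \<noteq> {}"
    using K by (simp add: symmetry_restricted_graph_def ordinary_graph_def bgraph_def
        connected_def strongly_connected_def)
  then obtain u where u: "u \<in> verts (dg K)" by blast
  show ?thesis
    using f u by (intro finite_common_covering[of "fv u" "fv' u"])
      (simp_all add: sr_morphism_def graph_hom_def)
qed

end
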